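(* For every integer $k\ge2$ and every $0\le\varepsilon<1$ there exist a family $X=X_{\delta,\Delta}$ of Euclidean $k$-means instances (indexed by $\delta,\Delta>0$ with $\Delta/\delta$ sufficiently large) and a valid $\varepsilon$-noisy adversary for $k$-means++ on these instances such that $$\lim_{\Delta/\delta\to\infty}\frac{\mathbf{E}_\varepsilon[\varphi(X,C)]}{\mathbf{E}_0[\varphi(X,C)]}\ \ge\ 1+\frac{\mathcal{H}_k-1}{\mathcal{H}_k}\,\varepsilon\ \ge\ 1+\frac{\varepsilon}{3}.$$ Here $\mathcal{H}_k=\sum_{m=1}^k 1/m$, $\mathbf{E}_\varepsilon$ denotes expectation when the $k$ centers $C$ are produced by $\varepsilon$-noisy $k$-means++ with this adversary, and $\mathbf{E}_0$ denotes expectation when $C$ is produced by exact $k$-means++. Consequently, a multiplicative loss of $1+\Omega(\varepsilon)$ with respect to exact $k$-means++ is unavoidable.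
   Context: For finite $X\subset\mathbb{R}^d$ and a nonempty finite set $C\subset\mathbb{R}^d$, $\varphi(X,C)=\sum_{x\in X}\min_{c\in C}\|x-c\|^2$ and $\varphi(x,C):=\varphi(\{x\},C)$. Exact $k$-means++ samples the first center uniformly from $X$ and then, given the set $C_j$ of the first $j$ centers ($1\le j<k$), samples the next center $x\in X$ with probability $p_{C_j}(x)=\varphi(x,C_j)/\varphi(X,C_j)$ and sets $C_{j+1}=C_j\cup\{x\}$; the output is $C=C_k$. $\varepsilon$-noisy $k$-means++ is the same procedure, except that a valid ($\varepsilon$-noisy) adversary, who may adapt to the history, replaces each sampling distribution by a probability distribution $q$ on $X$ that is pointwise within a factor in $[1-\varepsilon,1+\varepsilon]$ of the exact one: in the first round $q(x)\in[(1-\varepsilon)/|X|,(1+\varepsilon)/|X|]$, and in later rounds $(1-\varepsilon)p_{C_j}(x)\le q(x)\le(1+\varepsilon)p_{C_j}(x)$, for all $x\in X$. In the family, each $X_{\delta,\Delta}$ consists of $k$ clusters of equal size $m\geq 2$; distinct points in the same cluster are at distance $\delta$ and points in different clusters are at distance $\Delta$. *)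

theory Defs
  imports "HOL-Probability.Probability"
begin

text \<open>
  The dimension \<open>d\<close> is existentially quantified in the theorem, so it cannot be a type.
  Points of \<open>\<real>\<^sup>d\<close> are represented as elements of \<open>topspace (Euclidean_space d)\<close>,
  i.e. sequences \<open>nat \<Rightarrow> real\<close> vanishing from index \<open>d\<close> on.
\<close>

type_synonym point = "nat \<Rightarrow> real"

definition eucl_dist :: "nat \<Rightarrow> point \<Rightarrow> point \<Rightarrow> real" where
  "eucl_dist d x y = L2_set (\<lambda>i. x i - y i) {..<d}"

definition kmeans_cost :: "nat \<Rightarrow> point set \<Rightarrow> point set \<Rightarrow> real" where
  "kmeans_cost d X C = (\<Sum>x\<in>X. MIN c\<in>C. (eucl_dist d x c)\<^sup>2)"

text \<open>
  A history is the list of the centers sampled so far, in order of sampling; the current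
  set of centers is its set of elements.
\<close>

definition exact_prob :: "nat \<Rightarrow> point set \<Rightarrow> point list \<Rightarrow> point \<Rightarrow> real" where
  "exact_prob d X h x =
     (if x \<notin> X then 0
      else if h = [] then 1 / real (card X)
      else kmeans_cost d {x} (set h) / kmeans_cost d X (set h))"

definition exact_step :: "nat \<Rightarrow> point set \<Rightarrow> point list \<Rightarrow> point pmf" where
  "exact_step d X h = embed_pmf (exact_prob d X h)"

text \<open>
  \<open>exact_step\<close> is meaningful whenever the sampling rule is, i.e. unless the cost of a
  nonempty history is already 0.
\<close>

lemma kmeans_cost_nonneg:
  assumes "finite C" "C \<noteq> {}"
  shows "kmeans_cost d X C \<ge> 0"
  unfolding kmeans_cost_def using assms by (intro sum_nonneg) auto

lemma pmf_exact_step: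
  assumes "finite X" "X \<noteq> {}" "h \<noteq> [] \<Longrightarrow> kmeans_cost d X (set h) \<noteq> 0"
  shows "pmf (exact_step d X h) x = exact_prob d X h x"
proof -
  have nonneg: "exact_prob d X h y \<ge> 0" for y
    by (auto simp: exact_prob_def intro!: divide_nonneg_nonneg kmeans_cost_nonneg)
  have "(\<Sum>y\<in>X. exact_prob d X h y) = 1"
  proof (cases "h = []")
    case False
    have "(\<Sum>y\<in>X. kmeans_cost d {y} (set h)) = kmeans_cost d X (set h)"
      by (simp add: kmeans_cost_def)
    with False assms show ?thesis
      by (simp add: exact_prob_def flip: sum_divide_distrib)
  qed (use assms in \<open>simp add: exact_prob_def\<close>)
  moreover have "(\<integral>\<^sup>+y. ennreal (exact_prob d X h y) \<partial>count_space UNIV)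
      = (\<Sum>y\<in>X. ennreal (exact_prob d X h y))"
    using assms(1) by (intro nn_integral_count_space') (auto simp: exact_prob_def)
  ultimately have "(\<integral>\<^sup>+y. ennreal (exact_prob d X h y) \<partial>count_space UNIV) = 1"
    using nonneg by (simp add: sum_ennreal)
  with nonneg show ?thesis
    unfolding exact_step_def by (intro pmf_embed_pmf) auto
qed

text \<open>
  An adversary maps each history to the distribution of the next center. If the cost of some
  history of length between 1 and \<open>k - 1\<close> were 0, all bounds in \<open>valid_adversary\<close> would
  be 0 there (division by 0) and no adversary would be valid; so validity also excludes
  instances on which exact sampling is undefined.
\<close>

type_synonym adversary = "point list \<Rightarrow> point pmf"

definition valid_adversary :: "nat \<Rightarrow> nat \<Rightarrow> real \<Rightarrow> point set \<Rightarrow> adversary \<Rightarrow> bool" where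
  "valid_adversary d k \<epsilon> X q \<longleftrightarrow>
     (\<forall>h. set h \<subseteq> X \<and> length h < k \<longrightarrow>
        set_pmf (q h) \<subseteq> X \<and>
        (\<forall>x\<in>X. (1 - \<epsilon>) * exact_prob d X h x \<le> pmf (q h) x \<and>
               pmf (q h) x \<le> (1 + \<epsilon>) * exact_prob d X h x))"

primrec sample_centers :: "adversary \<Rightarrow> nat \<Rightarrow> point list pmf" where
  "sample_centers q 0 = return_pmf []"
| "sample_centers q (Suc j) =
     bind_pmf (sample_centers q j) (\<lambda>h. map_pmf (\<lambda>x. h @ [x]) (q h))"

definition expected_cost :: "nat \<Rightarrow> nat \<Rightarrow> point set \<Rightarrow> adversary \<Rightarrow> real" where
  "expected_cost d k X q =
     measure_pmf.expectation (sample_centers q k) (\<lambda>h. kmeans_cost d X (set h))"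

definition clustered_instance ::
    "nat \<Rightarrow> nat \<Rightarrow> nat \<Rightarrow> real \<Rightarrow> real \<Rightarrow> point set \<Rightarrow> bool" where
  "clustered_instance d k m \<delta> \<Delta> X \<longleftrightarrow>
     finite X \<and> X \<subseteq> topspace (Euclidean_space d) \<and>
     (\<exists>P. partition_on X P \<and> card P = k \<and> (\<forall>A\<in>P. card A = m) \<and>
          (\<forall>A\<in>P. \<forall>x\<in>A. \<forall>y\<in>A. x \<noteq> y \<longrightarrow> eucl_dist d x y = \<delta>) \<and>
          (\<forall>A\<in>P. \<forall>B\<in>P. A \<noteq> B \<longrightarrow> (\<forall>x\<in>A. \<forall>y\<in>B. eucl_dist d x y = \<Delta>)))"

text \<open>The limit \<open>\<Delta>/\<delta> \<rightarrow> \<infinity>\<close>, jointly over all pairs \<open>\<delta>, \<Delta> > 0\<close>.\<close>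

definition ratio_at_top :: "(real \<times> real) filter" where
  "ratio_at_top = inf (filtercomap (\<lambda>(\<delta>, \<Delta>). \<Delta> / \<delta>) at_top)
                      (principal {(\<delta>, \<Delta>). 0 < \<delta> \<and> 0 < \<Delta>})"

end

theory Submission
  imports Defs "HOL-Real_Asymp.Real_Asymp"
begin

text \<open>
  The adversary multiplies the probability of every point in an already covered cluster by
  \<open>1 + \<epsilon>\<close>. To first order in \<open>(\<delta>/\<Delta>)\<^sup>2\<close>, the final cost in units of \<open>\<delta>\<^sup>2\<close> consists of
  \<open>k(m - 1)\<close>, paid when all clusters are covered, and of \<open>m(\<Delta>/\<delta>)\<^sup>2\<close> times the expected number of
  misses. A miss in the round with \<open>j\<close> covered clusters has probability about
  \<open>(1 + \<epsilon>) j(m - 1)/((k - j)m) (\<delta>/\<Delta>)\<^sup>2\<close>, so the limiting cost is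
  \<open>(m - 1)(k + (1 + \<epsilon>) \<Sum>\<^sub>j j/(k - j)) = (m - 1) k (H\<^sub>k + \<epsilon>(H\<^sub>k - 1))\<close>, and the exact
  algorithm is the case \<open>\<epsilon> = 0\<close>.
\<close>

section \<open>The reweighting adversary\<close>

definition covered :: "'a set set \<Rightarrow> 'a set \<Rightarrow> 'a set set" where
  "covered P C = {A \<in> P. A \<inter> C \<noteq> {}}"

definition covered_prob :: "nat \<Rightarrow> point set \<Rightarrow> point set set \<Rightarrow> point list \<Rightarrow> real" where
  "covered_prob d X P h = (\<Sum>x\<in>\<Union>(covered P (set h)). exact_prob d X h x)"

text \<open>
  The factor on uncovered clusters restores total mass 1; it is at least \<open>1 - \<epsilon>\<close> as long as the
  covered clusters have probability at most \<open>1/2\<close>.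
\<close>

definition noisy_prob ::
    "nat \<Rightarrow> point set \<Rightarrow> point set set \<Rightarrow> real \<Rightarrow> point list \<Rightarrow> point \<Rightarrow> real" where
  "noisy_prob d X P \<epsilon> h x =
     (if x \<in> \<Union>(covered P (set h)) then 1 + \<epsilon>
      else 1 - \<epsilon> * covered_prob d X P h / (1 - covered_prob d X P h)) * exact_prob d X h x"

definition noisy_step :: "nat \<Rightarrow> point set \<Rightarrow> point set set \<Rightarrow> real \<Rightarrow> adversary" where
  "noisy_step d X P \<epsilon> h = embed_pmf (noisy_prob d X P \<epsilon> h)"

text \<open>Makes exact sampling the instance \<epsilon> = 0 of the noisy one, so that numerator and
  denominator of the ratio come from one computation with a general \<epsilon>.\<close>

lemma noisy_step_0: "noisy_step d X P 0 = exact_step d X"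
proof (intro ext)
  fix h
  have "noisy_prob d X P 0 h = exact_prob d X h"
    by (auto simp: noisy_prob_def)
  thus "noisy_step d X P 0 h = exact_step d X h"
    by (simp add: noisy_step_def exact_step_def)
qed

lemma pmf_embed_pmf_finite:
  assumes "finite X" "\<And>x. f x \<ge> 0" "\<And>x. x \<notin> X \<Longrightarrow> f x = 0" "sum f X = 1"
  shows "pmf (embed_pmf f) x = f x"
proof (rule pmf_embed_pmf)
  have "(\<integral>\<^sup>+y. ennreal (f y) \<partial>count_space UNIV) = (\<Sum>y\<in>X. ennreal (f y))"
    using assms by (intro nn_integral_count_space') auto
  thus "(\<integral>\<^sup>+y. ennreal (f y) \<partial>count_space UNIV) = 1"
    using assms by (simp add: sum_ennreal)
qed (use assms in auto)

lemma eucl_dist_self [simp]: "eucl_dist d x x = 0"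
  by (simp add: eucl_dist_def L2_set_def)

lemma kmeans_cost_Un:
  assumes "finite A" "finite B" "A \<inter> B = {}"
  shows "kmeans_cost d (A \<union> B) C = kmeans_cost d A C + kmeans_cost d B C"
  using assms by (simp add: kmeans_cost_def sum.union_disjoint)

section \<open>Asymptotics of the cost recursion\<close>

text \<open>
  Expected final cost in units of \<open>\<delta>\<^sup>2\<close> when \<open>n\<close> of the \<open>k\<close> rounds remain and \<open>t\<close> clusters are covered,
  with \<open>D = (\<Delta>/\<delta>)\<^sup>2\<close>. Sampled centers are almost surely distinct, hence \<open>t\<close> and \<open>n\<close> determine the
  current cost.
\<close>

fun cost_to_go :: "nat \<Rightarrow> nat \<Rightarrow> real \<Rightarrow> nat \<Rightarrow> nat \<Rightarrow> real \<Rightarrow> real" where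
  "cost_to_go k m \<epsilon> 0 t D = real t * real m - real k + (real k - real t) * real m * D"
| "cost_to_go k m \<epsilon> (Suc n) t D =
     (let u = real t * real m - (real k - real (Suc n));
          p = (1 + \<epsilon>) * (u / (u + (real k - real t) * real m * D))
      in p * cost_to_go k m \<epsilon> n t D + (1 - p) * cost_to_go k m \<epsilon> n (Suc t) D)"

text \<open>Miss probabilities vanish as \<open>D\<close> grows, so in the limit each of the
  \<open>n\<close> remaining rounds covers a new cluster and each of the k - n - t clusters left
  over costs m per unit of \<open>D\<close>. This leading order is all that is needed after a miss,
  because the miss itself has probability of order 1/D.\<close>

lemma cost_to_go_div_tendsto:
  assumes "t + n \<le> k" "m > 0"
  shows "((\<lambda>D. cost_to_go k m \<epsilon> n t D / D) \<longlongrightarrow> real m * (real k - real n - real t)) at_top"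
  using assms(1)
proof (induction n arbitrary: t)
  case 0
  show ?case
    by simp real_asymp
next
  case (Suc n)
  define u where "u = real t * real m - (real k - real (Suc n))"
  define w where "w = (real k - real t) * real m"
  have "w > 0" using Suc.prems assms(2) by (simp add: w_def)
  hence lim: "((\<lambda>D. (1 + \<epsilon>) * (u / (u + w * D))) \<longlongrightarrow> 0) at_top"
    by real_asymp
  have 1: "((\<lambda>D. cost_to_go k m \<epsilon> n t D / D) \<longlongrightarrow> real m * (real k - real n - real t)) at_top"
    using Suc.prems by (intro Suc.IH) auto
  have 2: "((\<lambda>D. cost_to_go k m \<epsilon> n (Suc t) D / D) \<longlongrightarrow> real m * (real k - real n - real (Suc t))) at_top"
    using Suc.prems by (intro Suc.IH) auto
  have "((\<lambda>D. (1 + \<epsilon>) * (u / (u + w * D)) * (cost_to_go k m \<epsilon> n t D / D) +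
      (1 - (1 + \<epsilon>) * (u / (u + w * D))) * (cost_to_go k m \<epsilon> n (Suc t) D / D)) \<longlongrightarrow>
      0 * (real m * (real k - real n - real t)) +
      (1 - 0) * (real m * (real k - real n - real (Suc t)))) at_top"
    by (intro tendsto_intros lim 1 2)
  also have "0 * (real m * (real k - real n - real t)) +
      (1 - 0) * (real m * (real k - real n - real (Suc t))) = real m * (real k - real (Suc n) - real t)"
    by (simp add: algebra_simps)
  finally show ?case
    by (simp add: Let_def add_divide_distrib flip: u_def w_def of_nat_Suc)
qed

text \<open>Having k - n clusters covered with \<open>n\<close> rounds left means that no miss has
  occurred yet. A miss in the next round leaves one cluster uncovered at the end; its cost of order
  \<open>D\<close> meets a probability of order 1/D, which adds a constant to the limit. Two or more
  misses are negligible.\<close>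

lemma cost_to_go_tendsto:
  assumes "n < k" "m > 0"
  shows "((\<lambda>D. cost_to_go k m \<epsilon> n (k - n) D) \<longlongrightarrow>
           (real m - 1) * (real k + (1 + \<epsilon>) * (real k * harm n - real n))) at_top"
  using assms(1)
proof (induction n)
  case 0
  show ?case
    by (simp add: algebra_simps harm_expand)
next
  case (Suc n)
  define t where "t = k - Suc n"
  define u where "u = real t * real m - (real k - real (Suc n))"
  define w where "w = (real k - real t) * real m"
  have t: "Suc t = k - n" "real t = real k - real n - 1"
    using Suc.prems by (auto simp: t_def)
  have w: "w > 0" and w_eq: "w = real (Suc n) * real m"
    using assms(2) by (simp_all add: w_def t)
  have lim: "((\<lambda>D. (1 + \<epsilon>) * (u / (u + w * D))) \<longlongrightarrow> 0) at_top"
    using w by real_asymp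
  have limD: "((\<lambda>D. (1 + \<epsilon>) * (u / (u + w * D)) * D) \<longlongrightarrow> (1 + \<epsilon>) * (u / w)) at_top"
  proof -
    have "((\<lambda>D. (u / (u + w * D)) * D) \<longlongrightarrow> u * inverse w) at_top"
      using w by real_asymp
    from tendsto_mult[OF tendsto_const[of "1 + \<epsilon>"] this] show ?thesis
      by (simp add: mult_ac divide_inverse)
  qed
  have 1: "((\<lambda>D. cost_to_go k m \<epsilon> n t D / D) \<longlongrightarrow> real m) at_top"
    using cost_to_go_div_tendsto[of t n k m \<epsilon>] Suc.prems assms(2) t by simp
  have 2: "((\<lambda>D. cost_to_go k m \<epsilon> n (Suc t) D) \<longlongrightarrow>
           (real m - 1) * (real k + (1 + \<epsilon>) * (real k * harm n - real n))) at_top"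
    using Suc.IH Suc.prems t by simp
  \<comment> \<open>On the miss branch a factor \<open>D\<close> is moved from the cost to the
    probability, so that both factors converge. The two occurrences of \<open>D\<close> cancel for D
    > 0, that is, eventually.\<close>
  have "((\<lambda>D. ((1 + \<epsilon>) * (u / (u + w * D)) * D) * (cost_to_go k m \<epsilon> n t D / D) +
      (1 - (1 + \<epsilon>) * (u / (u + w * D))) * cost_to_go k m \<epsilon> n (Suc t) D) \<longlongrightarrow>
      (1 + \<epsilon>) * (u / w) * real m +
      (1 - 0) * ((real m - 1) * (real k + (1 + \<epsilon>) * (real k * harm n - real n)))) at_top"
    by (intro tendsto_intros lim limD 1 2)
  also have "(1 + \<epsilon>) * (u / w) * real m +
      (1 - 0) * ((real m - 1) * (real k + (1 + \<epsilon>) * (real k * harm n - real n))) =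
      (real m - 1) * (real k + (1 + \<epsilon>) * (real k * harm (Suc n) - real (Suc n)))"
  proof -
    \<comment> \<open>The miss in this round contributes (m - 1)(k/(n + 1) - 1), up to the factor 1
      + \<epsilon>; this is m - 1 times the increment of k * harm n - n from \<open>n\<close> to
      \<open>Suc n\<close>.\<close>
    have "u = (real m - 1) * (real k - real (Suc n))"
      by (simp add: u_def t algebra_simps)
    hence "u / w * real m = (real m - 1) * (real k / real (Suc n) - 1)"
      using assms(2) by (simp add: w_eq divide_simps)
    hence "(1 + \<epsilon>) * (u / w) * real m = (1 + \<epsilon>) * ((real m - 1) * (real k / real (Suc n) - 1))"
      by (simp only: mult.assoc)
    moreover have "real k * harm (Suc n) = real k * harm n + real k / real (Suc n)"
      by (simp add: harm_Suc algebra_simps inverse_eq_divide)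
    ultimately show ?thesis
      by (simp add: algebra_simps)
  qed
  finally have *: "((\<lambda>D. ((1 + \<epsilon>) * (u / (u + w * D)) * D) * (cost_to_go k m \<epsilon> n t D / D) +
      (1 - (1 + \<epsilon>) * (u / (u + w * D))) * cost_to_go k m \<epsilon> n (Suc t) D) \<longlongrightarrow>
      (real m - 1) * (real k + (1 + \<epsilon>) * (real k * harm (Suc n) - real (Suc n)))) at_top" .
  show ?case
    unfolding t_def[symmetric]
  proof (rule Lim_transform_eventually[OF *])
    show "\<forall>\<^sub>F D in at_top. ((1 + \<epsilon>) * (u / (u + w * D)) * D) * (cost_to_go k m \<epsilon> n t D / D) +
      (1 - (1 + \<epsilon>) * (u / (u + w * D))) * cost_to_go k m \<epsilon> n (Suc t) D = cost_to_go k m \<epsilon> (Suc n) t D"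
      using eventually_gt_at_top[of 0]
      by eventually_elim (simp add: Let_def flip: u_def w_def of_nat_Suc)
  qed
qed


section \<open>Costs and sampling probabilities on clustered instances\<close>

locale clustering =
  fixes d k m :: nat and \<delta> \<Delta> :: real and X :: "point set" and P :: "point set set"
  assumes k: "k \<ge> 2" and m: "m \<ge> 2"
    and \<delta>: "\<delta> > 0" and \<Delta>: "real k * \<delta>\<^sup>2 \<le> \<Delta>\<^sup>2"
    and finite: "finite X" and part: "partition_on X P"
    and card_P: "card P = k" and card_cluster: "A \<in> P \<Longrightarrow> card A = m"
    and dist_same: "A \<in> P \<Longrightarrow> x \<in> A \<Longrightarrow> y \<in> A \<Longrightarrow> x \<noteq> y \<Longrightarrow> eucl_dist d x y = \<delta>"
    and dist_diff: "A \<in> P \<Longrightarrow> B \<in> P \<Longrightarrow> A \<noteq> B \<Longrightarrow> x \<in> A \<Longrightarrow> y \<in> B \<Longrightarrow> eucl_dist d x y = \<Delta>"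
begin

lemma \<delta>_le_\<Delta>: "\<delta>\<^sup>2 \<le> \<Delta>\<^sup>2"
proof -
  have "1 * \<delta>\<^sup>2 \<le> real k * \<delta>\<^sup>2"
    using k by (intro mult_right_mono) auto
  thus ?thesis using \<Delta> by simp
qed

lemma finite_P: "finite P"
  using finite part by (rule finite_elements)

lemma cluster_unique: "A \<in> P \<Longrightarrow> B \<in> P \<Longrightarrow> x \<in> A \<Longrightarrow> x \<in> B \<Longrightarrow> A = B"
  using partition_onD2[OF part] by (auto simp: disjoint_def)

lemma finite_cluster: "A \<in> P \<Longrightarrow> finite A"
  using card_cluster[of A] m by (intro card_ge_0_finite) auto

lemma card_X: "card X = k * m"
proof -
  have "card (\<Union>P) = (\<Sum>A\<in>P. card A)"
    using partition_onD2[OF part] finite_cluster by (intro card_Union_disjoint)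
  thus ?thesis
    using partition_onD1[OF part] card_P card_cluster by simp
qed

abbreviation "cov C \<equiv> covered P C"

lemma cov_subset: "cov C \<subseteq> P"
  by (auto simp: covered_def)

lemma Union_cov_subset: "\<Union>(cov C) \<subseteq> X"
  using cov_subset partition_onD1[OF part] by blast

lemma subset_Union_cov: "C \<subseteq> X \<Longrightarrow> C \<subseteq> \<Union>(cov C)"
  using partition_onD1[OF part] by (auto simp: covered_def)

lemma card_Union_cov: "card (\<Union>(cov C)) = card (cov C) * m"
proof -
  have "card (\<Union>(cov C)) = (\<Sum>A\<in>cov C. card A)"
    using partition_onD2[OF part] cov_subset[of C] finite_cluster
    by (intro card_Union_disjoint) (auto intro: pairwise_subset)
  thus ?thesis
    using cov_subset[of C] card_cluster by (simp add: subset_iff)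
qed

text \<open>Choosing one center in each covered cluster is injective because clusters are
  disjoint.\<close>

lemma card_cov_le: "C \<subseteq> X \<Longrightarrow> card (cov C) \<le> card C"
proof -
  assume C: "C \<subseteq> X"
  have "\<forall>A\<in>cov C. \<exists>x. x \<in> A \<inter> C"
    by (auto simp: covered_def)
  then obtain f where f: "\<forall>A\<in>cov C. f A \<in> A \<inter> C"
    by metis
  show ?thesis
  proof (rule card_inj_on_le)
    show "inj_on f (cov C)"
      using f cov_subset[of C] by (intro inj_onI) (metis IntD1 cluster_unique subsetD)
    show "f ` cov C \<subseteq> C" using f by auto
    show "finite C" using C finite by (rule finite_subset)
  qed
qed

lemma card_cov_insert:
  assumes "x \<in> X"
  shows "card (cov (insert x C)) = (if x \<in> \<Union>(cov C) then card (cov C) else Suc (card (cov C)))"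
proof -
  obtain A where A: "A \<in> P" "x \<in> A"
    using assms partition_onD1[OF part] by auto
  have eq: "cov (insert x C) = insert A (cov C)"
    using A cluster_unique by (auto simp: covered_def)
  have "x \<in> \<Union>(cov C) \<longleftrightarrow> A \<in> cov C"
    using A cluster_unique cov_subset[of C] by blast
  moreover have "finite (cov C)"
    using cov_subset finite_P by (rule finite_subset)
  ultimately show ?thesis
    by (simp add: eq card_insert_if)
qed

text \<open>Squared distances from a point take only the values 0, \<delta>^2 and \<Delta>^2, in
  increasing order, so the minimum depends only on whether the point is a center and whether its
  cluster contains one.\<close>

lemma cost_point:
  assumes "C \<subseteq> X" "C \<noteq> {}" "x \<in> X"
  shows "(MIN c\<in>C. (eucl_dist d x c)\<^sup>2) =
    (if x \<in> C then 0 else if x \<in> \<Union>(cov C) then \<delta>\<^sup>2 else \<Delta>\<^sup>2)"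
proof -
  have fin: "finite C" using assms(1) finite by (rule finite_subset)
  obtain A where A: "A \<in> P" "x \<in> A"
    using assms partition_onD1[OF part] by auto
  have dist: "(eucl_dist d x c)\<^sup>2 = (if c = x then 0 else if c \<in> A then \<delta>\<^sup>2 else \<Delta>\<^sup>2)" if c: "c \<in> C" for c
  proof -
    obtain B where B: "B \<in> P" "c \<in> B"
      using c assms(1) partition_onD1[OF part] by blast
    show ?thesis
      using dist_same[OF A(1) A(2), of c] dist_diff[OF A(1) B(1) _ A(2) B(2)] B(2) by auto
  qed
  have cov: "x \<in> \<Union>(cov C) \<longleftrightarrow> A \<inter> C \<noteq> {}"
    using A cluster_unique by (auto simp: covered_def)
  have MIN: "(MIN c\<in>C. (eucl_dist d x c)\<^sup>2) = v"
    if "c \<in> C" "(eucl_dist d x c)\<^sup>2 = v" "\<And>c. c \<in> C \<Longrightarrow> v \<le> (eucl_dist d x c)\<^sup>2" for c v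
    using that fin by (intro Min_eqI) auto
  show ?thesis
  proof (cases "x \<in> C")
    case True
    thus ?thesis by (simp add: MIN[OF True])
  next
    case False
    show ?thesis
    proof (cases "x \<in> \<Union>(cov C)")
      case True
      then obtain c where "c \<in> A" "c \<in> C" using cov by auto
      hence "(MIN c\<in>C. (eucl_dist d x c)\<^sup>2) = \<delta>\<^sup>2"
        using False \<delta>_le_\<Delta> dist by (intro MIN[of c]) auto
      thus ?thesis using True False by simp
    next
      case uncov: False
      obtain c where "c \<in> C" using assms by auto
      hence "(MIN c\<in>C. (eucl_dist d x c)\<^sup>2) = \<Delta>\<^sup>2"
        using False uncov cov dist by (intro MIN[of c]) auto
      thus ?thesis using uncov False by simp
    qed
  qed
qed

lemma cost_Union_cov:
  assumes "C \<subseteq> X" "C \<noteq> {}"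
  shows "kmeans_cost d (\<Union>(cov C)) C = (real (card (cov C)) * real m - real (card C)) * \<delta>\<^sup>2"
proof -
  have fin: "finite (\<Union>(cov C))"
    using Union_cov_subset finite by (rule finite_subset)
  have "kmeans_cost d (\<Union>(cov C)) C = (\<Sum>x\<in>\<Union>(cov C). if x \<in> C then 0 else \<delta>\<^sup>2)"
    unfolding kmeans_cost_def
    using Union_cov_subset[of C] by (intro sum.cong refl, subst cost_point[OF assms]) auto
  also have "\<dots> = (\<Sum>x\<in>\<Union>(cov C) - C. \<delta>\<^sup>2)"
    by (rule sum.mono_neutral_cong_right) (use fin in auto)
  also have "\<dots> = real (card (\<Union>(cov C)) - card C) * \<delta>\<^sup>2"
    using subset_Union_cov[OF assms(1)] fin by (simp add: card_Diff_subset finite_subset)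
  finally show ?thesis
    using card_mono[OF fin subset_Union_cov[OF assms(1)]] by (simp add: of_nat_diff card_Union_cov)
qed

text \<open>Centers lie in covered clusters and pay 0, the other points there pay \<delta>^2, and
  all remaining points pay \<Delta>^2. The cost thus depends on \<open>C\<close> only through two
  cardinalities, which reduces the process to a chain on the number of covered clusters.\<close>

lemma cost_eq:
  assumes "C \<subseteq> X" "C \<noteq> {}"
  shows "kmeans_cost d X C = (real (card (cov C)) * real m - real (card C)) * \<delta>\<^sup>2 +
           (real k - real (card (cov C))) * real m * \<Delta>\<^sup>2"
proof -
  let ?U = "\<Union>(cov C)"
  have U: "?U \<subseteq> X" "finite ?U"
    using Union_cov_subset finite by (auto intro: finite_subset)
  have "kmeans_cost d (X - ?U) C = (\<Sum>x\<in>X - ?U. \<Delta>\<^sup>2)"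
    unfolding kmeans_cost_def using subset_Union_cov[OF assms(1)]
    by (intro sum.cong refl) (auto simp: cost_point[OF assms] subset_iff)
  also have "\<dots> = real (card X - card ?U) * \<Delta>\<^sup>2"
    using U by (simp add: card_Diff_subset)
  also have "\<dots> = (real k - real (card (cov C))) * real m * \<Delta>\<^sup>2"
    using card_mono[OF finite U(1)] by (simp add: of_nat_diff card_Union_cov card_X algebra_simps)
  finally show ?thesis
    using kmeans_cost_Un[of ?U "X - ?U" d C] U finite cost_Union_cov[OF assms]
    by (simp add: Un_absorb1)
qed

lemma card_cov_less:
  assumes "set h \<subseteq> X" "length h < k"
  shows "card (cov (set h)) < k"
  using card_cov_le[OF assms(1)] card_length[of h] assms(2) by linarith

text \<open>Fewer than k centers leave some cluster uncovered; hence the sampling rule never divides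
  by 0.\<close>

lemma cost_pos:
  assumes "set h \<subseteq> X" "length h < k" "h \<noteq> []"
  shows "kmeans_cost d X (set h) > 0"
proof -
  have "kmeans_cost d (\<Union>(cov (set h))) (set h) \<ge> 0"
    using assms by (intro kmeans_cost_nonneg) auto
  moreover have "(real k - real (card (cov (set h)))) * real m * \<Delta>\<^sup>2 > 0"
    using card_cov_less[OF assms(1,2)] m \<delta> \<delta>_le_\<Delta>
    by (intro mult_pos_pos) (auto intro: less_le_trans[of 0 "\<delta>\<^sup>2"])
  ultimately show ?thesis
    using assms by (simp add: cost_eq cost_Union_cov)
qed

lemma exact_prob_nonneg: "exact_prob d X h x \<ge> 0"
  by (auto simp: exact_prob_def intro!: divide_nonneg_nonneg kmeans_cost_nonneg)

lemma sum_exact_prob: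
  assumes "set h \<subseteq> X" "length h < k"
  shows "(\<Sum>x\<in>X. exact_prob d X h x) = 1"
proof (cases "h = []")
  case True
  thus ?thesis using k m by (simp add: exact_prob_def card_X)
next
  case False
  have "(\<Sum>y\<in>X. kmeans_cost d {y} (set h)) = kmeans_cost d X (set h)"
    by (simp add: kmeans_cost_def)
  thus ?thesis
    using False cost_pos[OF assms False] by (simp add: exact_prob_def flip: sum_divide_distrib)
qed

text \<open>Consequently the adversary leaves the first, uniform round unchanged, and the first
  center surely covers a new cluster.\<close>

lemma covered_prob_Nil: "covered_prob d X P [] = 0"
  by (simp add: covered_prob_def covered_def)

lemma covered_prob_eq:
  assumes "set h \<subseteq> X" "h \<noteq> []"
  shows "covered_prob d X P h = kmeans_cost d (\<Union>(cov (set h))) (set h) / kmeans_cost d X (set h)"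
proof -
  have "covered_prob d X P h =
      (\<Sum>x\<in>\<Union>(cov (set h)). kmeans_cost d {x} (set h) / kmeans_cost d X (set h))"
    unfolding covered_prob_def using Union_cov_subset[of "set h"] assms
    by (intro sum.cong refl) (auto simp: exact_prob_def)
  also have "\<dots> = (\<Sum>x\<in>\<Union>(cov (set h)). kmeans_cost d {x} (set h)) / kmeans_cost d X (set h)"
    by (simp add: sum_divide_distrib)
  finally show ?thesis by (simp add: kmeans_cost_def)
qed

text \<open>The covered clusters together cost at most k m \<delta>^2. Some cluster is still
  uncovered and costs m \<Delta>^2, which is no less by the locale assumption
  \<open>\<Delta>\<close>. So the covered part is at most half of the total.\<close>

lemma covered_prob_bounds:
  assumes "set h \<subseteq> X" "length h < k"
  shows "0 \<le> covered_prob d X P h" "covered_prob d X P h \<le> 1 / 2"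
proof -
  show "0 \<le> covered_prob d X P h"
    by (auto simp: covered_prob_def intro: sum_nonneg exact_prob_nonneg)
  show "covered_prob d X P h \<le> 1 / 2"
  proof (cases "h = []")
    case True
    thus ?thesis by (simp add: covered_prob_Nil)
  next
    case False
    let ?t = "real (card (cov (set h)))"
    have t: "card (cov (set h)) < k" by (rule card_cov_less[OF assms])
    have "(?t * real m - real (card (set h))) * \<delta>\<^sup>2 \<le> (real k * real m) * \<delta>\<^sup>2"
      using t mult_right_mono[of ?t "real k" "real m"] by (intro mult_right_mono) auto
    also have "\<dots> \<le> real m * \<Delta>\<^sup>2"
      using mult_left_mono[OF \<Delta>, of "real m"] by (simp add: mult_ac)
    also have "\<dots> \<le> (real k - ?t) * (real m * \<Delta>\<^sup>2)"
      using t mult_right_mono[of 1 "real k - ?t" "real m * \<Delta>\<^sup>2"] by simp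
    finally show ?thesis
      using cost_pos[OF assms False] assms False
      by (simp add: covered_prob_eq cost_Union_cov cost_eq field_simps)
  qed
qed

section \<open>The noisy process and its expected cost\<close>

context
  fixes \<epsilon> :: real
  assumes \<epsilon>: "0 \<le> \<epsilon>" "\<epsilon> < 1"
begin

text \<open>The correction is \<epsilon> times the odds p/(1 - p) of a miss under exact sampling,
  and these odds lie between 0 and 1 because p is at most 1/2.\<close>

lemma uncovered_factor_bounds:
  assumes "set h \<subseteq> X" "length h < k"
  defines "f \<equiv> 1 - \<epsilon> * covered_prob d X P h / (1 - covered_prob d X P h)"
  shows "1 - \<epsilon> \<le> f" "f \<le> 1"
proof -
  have p: "0 \<le> covered_prob d X P h" "covered_prob d X P h \<le> 1 / 2"
    using covered_prob_bounds[OF assms(1,2)] .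
  have "covered_prob d X P h / (1 - covered_prob d X P h) \<le> 1"
    using p by simp
  from mult_left_mono[OF this \<epsilon>(1)] show "1 - \<epsilon> \<le> f"
    by (simp add: f_def)
  show "f \<le> 1"
    unfolding f_def using p \<epsilon> by simp
qed

lemma noisy_prob_bounds:
  assumes "set h \<subseteq> X" "length h < k"
  shows "(1 - \<epsilon>) * exact_prob d X h x \<le> noisy_prob d X P \<epsilon> h x"
    and "noisy_prob d X P \<epsilon> h x \<le> (1 + \<epsilon>) * exact_prob d X h x"
  unfolding noisy_prob_def
  using uncovered_factor_bounds[OF assms] \<epsilon>
  by (auto intro!: mult_right_mono exact_prob_nonneg)

lemma sum_noisy_prob_covered:
  "(\<Sum>x\<in>\<Union>(cov (set h)). noisy_prob d X P \<epsilon> h x) = (1 + \<epsilon>) * covered_prob d X P h"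
  by (simp add: noisy_prob_def covered_prob_def sum_distrib_left)

lemma sum_noisy_prob_uncovered:
  assumes "set h \<subseteq> X" "length h < k"
  shows "(\<Sum>x\<in>X - \<Union>(cov (set h)). noisy_prob d X P \<epsilon> h x) = 1 - (1 + \<epsilon>) * covered_prob d X P h"
proof -
  let ?U = "\<Union>(cov (set h))" and ?p = "covered_prob d X P h"
  have "(\<Sum>x\<in>X - ?U. noisy_prob d X P \<epsilon> h x) =
      (1 - \<epsilon> * ?p / (1 - ?p)) * (\<Sum>x\<in>X - ?U. exact_prob d X h x)"
    by (simp add: noisy_prob_def sum_distrib_left)
  also have "(\<Sum>x\<in>X - ?U. exact_prob d X h x) = 1 - ?p"
    using sum_diff[OF finite Union_cov_subset, of "exact_prob d X h" "set h"] sum_exact_prob[OF assms] by (simp add: covered_prob_def)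
  also have "(1 - \<epsilon> * ?p / (1 - ?p)) * (1 - ?p) = 1 - (1 + \<epsilon>) * ?p"
    using covered_prob_bounds[OF assms] by (simp add: field_simps)
  finally show ?thesis .
qed

lemma pmf_noisy_step:
  assumes "set h \<subseteq> X" "length h < k"
  shows "pmf (noisy_step d X P \<epsilon> h) x = noisy_prob d X P \<epsilon> h x"
  unfolding noisy_step_def
proof (rule pmf_embed_pmf_finite[OF finite])
  show "noisy_prob d X P \<epsilon> h x \<ge> 0" for x
    using noisy_prob_bounds(1)[OF assms, of x] exact_prob_nonneg[of h x] \<epsilon>
    by (meson diff_ge_0_iff_ge less_imp_le mult_nonneg_nonneg order_trans)
  show "noisy_prob d X P \<epsilon> h x = 0" if "x \<notin> X" for x
    using that by (simp add: noisy_prob_def exact_prob_def)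
  show "sum (noisy_prob d X P \<epsilon> h) X = 1"
    using sum.subset_diff[OF Union_cov_subset finite, of "noisy_prob d X P \<epsilon> h" "set h"]
    by (simp add: sum_noisy_prob_covered sum_noisy_prob_uncovered[OF assms])
qed

text \<open>A center already chosen has cost 0 and hence probability 0. This keeps the sampled
  centers distinct, so their number equals the number of completed rounds.\<close>

lemma set_noisy_step:
  assumes "set h \<subseteq> X" "length h < k"
  shows "set_pmf (noisy_step d X P \<epsilon> h) \<subseteq> X - set h"
proof
  fix x assume "x \<in> set_pmf (noisy_step d X P \<epsilon> h)"
  hence "exact_prob d X h x \<noteq> 0"
    by (auto simp: set_pmf_iff pmf_noisy_step[OF assms] noisy_prob_def)
  moreover from this have "x \<in> X"
    by (auto simp: exact_prob_def split: if_splits)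
  ultimately show "x \<in> X - set h"
    using assms(1) by (cases "h = []") (auto simp: exact_prob_def kmeans_cost_def cost_point)
qed

lemma valid_adversary_noisy_step: "valid_adversary d k \<epsilon> X (noisy_step d X P \<epsilon>)"
  unfolding valid_adversary_def
  using set_noisy_step noisy_prob_bounds by (auto simp: pmf_noisy_step)

lemma set_sample_centers:
  assumes "j \<le> k" "h \<in> set_pmf (sample_centers (noisy_step d X P \<epsilon>) j)"
  shows "set h \<subseteq> X \<and> length h = j \<and> distinct h"
  using assms
proof (induction j arbitrary: h)
  case (Suc j)
  then obtain g x where g: "g \<in> set_pmf (sample_centers (noisy_step d X P \<epsilon>) j)"
      "x \<in> set_pmf (noisy_step d X P \<epsilon> g)" "h = g @ [x]"
    by auto
  moreover have IH: "set g \<subseteq> X \<and> length g = j \<and> distinct g"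
    using Suc g(1) by simp
  ultimately show ?case
    using set_noisy_step[of g] Suc.prems(1) by auto
qed auto

text \<open>One step of the chain on the number of covered clusters: it stays put on a miss, of
  probability (1 + \<epsilon>) p with p = \<open>covered_prob d X P h\<close>, and otherwise grows
  by one.\<close>

lemma expectation_noisy_step:
  fixes f :: "nat \<Rightarrow> real"
  assumes "set h \<subseteq> X" "length h < k"
  shows "measure_pmf.expectation (noisy_step d X P \<epsilon> h) (\<lambda>x. f (card (cov (set (h @ [x]))))) =
    (1 + \<epsilon>) * covered_prob d X P h * f (card (cov (set h))) +
    (1 - (1 + \<epsilon>) * covered_prob d X P h) * f (Suc (card (cov (set h))))"
proof -
  let ?U = "\<Union>(cov (set h))" and ?t = "card (cov (set h))"
  let ?q = "noisy_prob d X P \<epsilon> h"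
  have "measure_pmf.expectation (noisy_step d X P \<epsilon> h) (\<lambda>x. f (card (cov (set (h @ [x]))))) =
      (\<Sum>x\<in>X. f (card (cov (set (h @ [x])))) * ?q x)"
    using set_noisy_step[OF assms]
    by (subst integral_measure_pmf_real[OF finite]) (auto simp: pmf_noisy_step[OF assms])
  also have "\<dots> = (\<Sum>x\<in>X. f (if x \<in> ?U then ?t else Suc ?t) * ?q x)"
    by (intro sum.cong refl) (simp add: card_cov_insert)
  also have "\<dots> = (\<Sum>x\<in>X - ?U. f (if x \<in> ?U then ?t else Suc ?t) * ?q x) +
      (\<Sum>x\<in>?U. f (if x \<in> ?U then ?t else Suc ?t) * ?q x)"
    by (rule sum.subset_diff[OF Union_cov_subset finite])
  also have "(\<Sum>x\<in>X - ?U. f (if x \<in> ?U then ?t else Suc ?t) * ?q x) = f (Suc ?t) * (\<Sum>x\<in>X - ?U. ?q x)"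
    unfolding sum_distrib_left by (intro sum.cong) auto
  also have "(\<Sum>x\<in>?U. f (if x \<in> ?U then ?t else Suc ?t) * ?q x) = f ?t * (\<Sum>x\<in>?U. ?q x)"
    unfolding sum_distrib_left by (intro sum.cong) auto
  finally show ?thesis
    by (simp add: sum_noisy_prob_covered sum_noisy_prob_uncovered[OF assms])
qed

text \<open>A martingale argument: \<open>cost_to_go\<close> solves the backward recursion of the
  chain, so its expectation along the process stays constant. It starts after the first round, with
  one cluster covered, since the transition formula presupposes a nonempty set of centers.\<close>

lemma expectation_cost_to_go:
  assumes "j < k"
  shows "measure_pmf.expectation (sample_centers (noisy_step d X P \<epsilon>) (Suc j))
           (\<lambda>h. cost_to_go k m \<epsilon> (k - Suc j) (card (cov (set h))) ((\<Delta> / \<delta>)\<^sup>2)) =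
         cost_to_go k m \<epsilon> (k - 1) 1 ((\<Delta> / \<delta>)\<^sup>2)"
  using assms
proof (induction j)
  case 0
  have "measure_pmf.expectation (noisy_step d X P \<epsilon> [])
      (\<lambda>x. cost_to_go k m \<epsilon> (k - 1) (card (cov (set ([] @ [x])))) ((\<Delta> / \<delta>)\<^sup>2)) =
      cost_to_go k m \<epsilon> (k - 1) 1 ((\<Delta> / \<delta>)\<^sup>2)"
    using k by (subst expectation_noisy_step) (auto simp: covered_prob_Nil covered_def)
  thus ?case by (simp add: bind_return_pmf)
next
  case (Suc j)
  define n where "n = k - Suc (Suc j)"
  \<comment> \<open>The number \<open>k - Suc n\<close> subtracted in \<open>cost_to_go\<close> is
    the number \<open>Suc j\<close> of centers in the current history.\<close>
  have n: "k - Suc j = Suc n" "real k - real (Suc n) = real (Suc j)"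
    using Suc.prems by (auto simp: n_def)
  let ?q = "noisy_step d X P \<epsilon>"
  let ?S = "sample_centers ?q (Suc j)"
  define V where "V = (\<lambda>n t. cost_to_go k m \<epsilon> n t ((\<Delta> / \<delta>)\<^sup>2))"
  \<comment> \<open>Finite supports allow expectations to be rewritten as finite sums.\<close>
  have fin: "finite (set_pmf (sample_centers ?q i))" if "i \<le> k" for i
  proof (rule finite_subset)
    show "set_pmf (sample_centers ?q i) \<subseteq> {h. set h \<subseteq> X \<and> length h = i}"
      using set_sample_centers[OF that] by blast
  qed (rule finite_lists_length_eq[OF finite])
  have step: "measure_pmf.expectation (map_pmf (\<lambda>x. h @ [x]) (?q h)) (\<lambda>h. V n (card (cov (set h)))) =
      V (Suc n) (card (cov (set h)))" if h: "h \<in> set_pmf ?S" for h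
  proof -
    have *: "set h \<subseteq> X" "length h = Suc j" "distinct h"
      using set_sample_centers[OF _ h] Suc.prems by auto
    let ?t = "card (cov (set h))"
    let ?u = "real ?t * real m - real (Suc j)"
    have "h \<noteq> []" "length h < k" using * Suc.prems by auto
    \<comment> \<open>Factoring \<delta>^2 out of the denominator exposes the quotient used in
      \<open>cost_to_go\<close>; distinctness of \<open>h\<close> identifies the number of centers
      with \<open>Suc j\<close>.\<close>
    have "covered_prob d X P h =
        ?u * \<delta>\<^sup>2 / ((?u + (real k - real ?t) * real m * (\<Delta> / \<delta>)\<^sup>2) * \<delta>\<^sup>2)"
      using * \<open>h \<noteq> []\<close> \<delta>
      by (simp add: covered_prob_eq cost_Union_cov cost_eq distinct_card algebra_simps power_divide)
    hence p: "covered_prob d X P h = ?u / (?u + (real k - real ?t) * real m * (\<Delta> / \<delta>)\<^sup>2)"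
      using \<delta> by simp
    have "measure_pmf.expectation (map_pmf (\<lambda>x. h @ [x]) (?q h)) (\<lambda>h. V n (card (cov (set h)))) =
        (1 + \<epsilon>) * covered_prob d X P h * V n ?t +
        (1 - (1 + \<epsilon>) * covered_prob d X P h) * V n (Suc ?t)"
      unfolding integral_map_pmf by (rule expectation_noisy_step[OF *(1) \<open>length h < k\<close>])
    also have "\<dots> = V (Suc n) ?t"
      unfolding V_def cost_to_go.simps Let_def n p ..
    finally show ?thesis .
  qed
  have "measure_pmf.expectation (sample_centers ?q (Suc (Suc j))) (\<lambda>h. V n (card (cov (set h)))) =
      (\<Sum>h\<in>set_pmf ?S. pmf ?S h *\<^sub>R
         measure_pmf.expectation (map_pmf (\<lambda>x. h @ [x]) (?q h)) (\<lambda>h. V n (card (cov (set h)))))"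
    unfolding sample_centers.simps(2)[of _ "Suc j"]
  proof (rule pmf_expectation_bind)
    fix h assume h: "h \<in> set_pmf ?S"
    have "set h \<subseteq> X" "length h < k"
      using set_sample_centers[OF _ h] Suc.prems by auto
    hence "finite (set_pmf (?q h))"
      using set_noisy_step finite by (meson finite_Diff finite_subset)
    thus "finite (set_pmf (map_pmf (\<lambda>x. h @ [x]) (?q h)))" by simp
  qed (use fin[of "Suc j"] Suc.prems in auto)
  also have "\<dots> = (\<Sum>h\<in>set_pmf ?S. V (Suc n) (card (cov (set h))) * pmf ?S h)"
    by (intro sum.cong refl) (simp only: step, simp)
  also have "\<dots> = measure_pmf.expectation ?S (\<lambda>h. V (Suc n) (card (cov (set h))))"
    using fin[of "Suc j"] Suc.prems by (intro integral_measure_pmf_real[symmetric]) auto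
  also have "\<dots> = V (k - 1) 1"
    using Suc.IH Suc.prems unfolding V_def n by simp
  finally show ?case
    unfolding V_def n_def .
qed

lemma expected_cost_noisy_step:
  "expected_cost d k X (noisy_step d X P \<epsilon>) = \<delta>\<^sup>2 * cost_to_go k m \<epsilon> (k - 1) 1 ((\<Delta> / \<delta>)\<^sup>2)"
proof -
  let ?S = "sample_centers (noisy_step d X P \<epsilon>) k"
  have "expected_cost d k X (noisy_step d X P \<epsilon>) =
      measure_pmf.expectation ?S (\<lambda>h. \<delta>\<^sup>2 * cost_to_go k m \<epsilon> 0 (card (cov (set h))) ((\<Delta> / \<delta>)\<^sup>2))"
    unfolding expected_cost_def
  proof (intro integral_cong_AE AE_pmfI)
    fix h assume "h \<in> set_pmf ?S"
    from set_sample_centers[OF _ this] have *: "set h \<subseteq> X" "length h = k" "distinct h" by auto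
    hence "h \<noteq> []" using k by auto
    thus "kmeans_cost d X (set h) = \<delta>\<^sup>2 * cost_to_go k m \<epsilon> 0 (card (cov (set h))) ((\<Delta> / \<delta>)\<^sup>2)"
      using * \<delta> by (simp add: cost_eq distinct_card algebra_simps power_divide)
  qed auto
  also have "\<dots> = \<delta>\<^sup>2 * cost_to_go k m \<epsilon> (k - 1) 1 ((\<Delta> / \<delta>)\<^sup>2)"
    using expectation_cost_to_go[of "k - 1"] k by simp
  finally show ?thesis .
qed

end

end


section \<open>Euclidean realization of the clusters\<close>

text \<open>
  Points \<open>a e\<^sub>i + b e\<^bsub>k+im+j\<^esub>\<close> with \<open>2 b\<^sup>2 = \<delta>\<^sup>2\<close> and \<open>2 a\<^sup>2 + 2 b\<^sup>2 = \<Delta>\<^sup>2\<close>.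
\<close>

definition grid_point :: "nat \<Rightarrow> nat \<Rightarrow> real \<Rightarrow> real \<Rightarrow> nat \<Rightarrow> nat \<Rightarrow> point" where
  "grid_point k m \<delta> \<Delta> i j n = sqrt ((\<Delta>\<^sup>2 - \<delta>\<^sup>2) / 2) * of_bool (n = i) + \<delta> / sqrt 2 * of_bool (n = k + i * m + j)"

definition grid_clusters :: "nat \<Rightarrow> nat \<Rightarrow> real \<Rightarrow> real \<Rightarrow> point set set" where
  "grid_clusters k m \<delta> \<Delta> = (\<lambda>i. grid_point k m \<delta> \<Delta> i ` {..<m}) ` {..<k}"

abbreviation grid :: "nat \<Rightarrow> nat \<Rightarrow> real \<Rightarrow> real \<Rightarrow> point set" where
  "grid k m \<delta> \<Delta> \<equiv> \<Union>(grid_clusters k m \<delta> \<Delta>)"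

text \<open>The squared distance of two standard unit vectors.\<close>

lemma sum_of_bool_diff_square:
  fixes i j N :: nat
  assumes "i < N" "j < N"
  shows "(\<Sum>n<N. (of_bool (n = i) - of_bool (n = j) :: real)\<^sup>2) = (if i = j then 0 else 2)"
proof (cases "i = j")
  case False
  have "(\<Sum>n<N. (of_bool (n = i) - of_bool (n = j) :: real)\<^sup>2) =
      (\<Sum>n<N. (if n = i then 1 else 0) + (if n = j then 1 else 0))"
    using False by (intro sum.cong) auto
  thus ?thesis
    using assms False by (simp add: sum.distrib)
qed simp

lemma grid_index_less:
  fixes i j k m :: nat
  assumes "i < k" "j < m"
  shows "k + i * m + j < k + k * m"
proof -
  have "Suc i * m \<le> k * m" using assms by (intro mult_right_mono) auto
  thus ?thesis using assms by simp
qed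

text \<open>Quotient and remainder modulo \<open>m\<close> recover the two indices, so every grid
  point has a coordinate of its own.\<close>

lemma grid_index_eq_iff:
  fixes i i' j j' m :: nat
  assumes "j < m" "j' < m"
  shows "i * m + j = i' * m + j' \<longleftrightarrow> i = i' \<and> j = j'"
proof
  assume eq: "i * m + j = i' * m + j'"
  have "(i * m + j) div m = i" "(i' * m + j') div m = i'"
    using assms by auto
  with eq show "i = i' \<and> j = j'" by simp
qed auto

lemma eucl_dist_grid_point:
  assumes "i < k" "i' < k" "j < m" "j' < m" "0 < \<delta>" "\<delta> \<le> \<Delta>"
  shows "eucl_dist (k + k * m) (grid_point k m \<delta> \<Delta> i j) (grid_point k m \<delta> \<Delta> i' j') =
    (if i \<noteq> i' then \<Delta> else if j \<noteq> j' then \<delta> else 0)"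
proof -
  let ?e = "k + i * m + j" and ?e' = "k + i' * m + j'" and ?N = "k + k * m"
  define a b where "a = sqrt ((\<Delta>\<^sup>2 - \<delta>\<^sup>2) / 2)" and "b = \<delta> / sqrt 2"
  have grid_point: "grid_point k m \<delta> \<Delta> i j n = a * of_bool (n = i) + b * of_bool (n = k + i * m + j)" for i j n
    by (simp only: grid_point_def a_def b_def)
  have "\<delta>\<^sup>2 \<le> \<Delta>\<^sup>2" using assms by (intro power_mono) auto
  hence ab: "a\<^sup>2 = (\<Delta>\<^sup>2 - \<delta>\<^sup>2) / 2" "b\<^sup>2 = \<delta>\<^sup>2 / 2"
    by (simp_all add: a_def b_def power_divide)
  have less: "?e < ?N" "?e' < ?N" "i < ?N" "i' < ?N"
    using grid_index_less[OF assms(1,3)] grid_index_less[OF assms(2,4)] assms by auto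
  \<comment> \<open>The cluster coordinates \<open>i\<close>, \<open>i'\<close> are below k and the
    individual coordinates are at least k, so all mixed products vanish.\<close>
  have "(\<Sum>n<?N. (grid_point k m \<delta> \<Delta> i j n - grid_point k m \<delta> \<Delta> i' j' n)\<^sup>2) =
      (\<Sum>n<?N. a\<^sup>2 * (of_bool (n = i) - of_bool (n = i'))\<^sup>2 + b\<^sup>2 * (of_bool (n = ?e) - of_bool (n = ?e'))\<^sup>2)"
    using assms(1,2)
    by (intro sum.cong refl) (auto simp: grid_point power2_eq_square algebra_simps)
  also have "\<dots> = a\<^sup>2 * (if i = i' then 0 else 2) + b\<^sup>2 * (if ?e = ?e' then 0 else 2)"
    unfolding sum.distrib sum_distrib_left[symmetric]
    using less by (simp only: sum_of_bool_diff_square)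
  also have "?e = ?e' \<longleftrightarrow> i = i' \<and> j = j'"
    using grid_index_eq_iff[OF assms(3,4)] by (simp add: add.assoc)
  also have "a\<^sup>2 * (if i = i' then 0 else 2) + b\<^sup>2 * (if i = i' \<and> j = j' then 0 else 2) =
      (if i \<noteq> i' then \<Delta> else if j \<noteq> j' then \<delta> else 0)\<^sup>2"
    by (auto simp: ab field_simps)
  finally show ?thesis
    using assms by (simp add: eucl_dist_def L2_set_def)
qed

lemma grid_subset_Euclidean_space: "grid k m \<delta> \<Delta> \<subseteq> topspace (Euclidean_space (k + k * m))"
proof
  fix x assume "x \<in> grid k m \<delta> \<Delta>"
  then obtain i j where "i < k" "j < m" "x = grid_point k m \<delta> \<Delta> i j"
    by (auto simp: grid_clusters_def)
  with grid_index_less[of i k j m] show "x \<in> topspace (Euclidean_space (k + k * m))"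
    by (auto simp: topspace_Euclidean_space grid_point_def)
qed

lemma clustering_grid:
  assumes "2 \<le> k" "2 \<le> m" "0 < \<delta>" "0 < \<Delta>" "real k \<le> \<Delta> / \<delta>"
  shows "clustering (k + k * m) k m \<delta> \<Delta> (grid k m \<delta> \<Delta>) (grid_clusters k m \<delta> \<Delta>)"
proof -
  let ?x = "grid_point k m \<delta> \<Delta>"
  have k\<delta>: "real k * \<delta> \<le> \<Delta>" using assms by (simp add: field_simps)
  have "1 * \<delta> \<le> real k * \<delta>" using assms by (intro mult_right_mono) auto
  with k\<delta> have le: "\<delta> \<le> \<Delta>" by simp
  note dist = eucl_dist_grid_point[OF _ _ _ _ assms(3) le]
  have eq_iff: "?x i j = ?x i' j' \<longleftrightarrow> i = i' \<and> j = j'" if "i < k" "i' < k" "j < m" "j' < m" for i i' j j'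
    using dist[OF that] assms by (auto split: if_splits)
  have disj: "?x i ` {..<m} \<inter> ?x i' ` {..<m} = {}" if "i < k" "i' < k" "i \<noteq> i'" for i i'
    using that by (auto simp: eq_iff)
  show ?thesis
  proof
    \<comment> \<open>The threshold on \<Delta>/\<delta> is linear in k while the locale compares
      squares; k \<le> k^2 bridges the two.\<close>
    have "real k * \<delta>\<^sup>2 \<le> (real k * \<delta>)\<^sup>2"
      using assms self_le_power[of "real k" 2] by (simp add: power_mult_distrib mult_right_mono)
    also have "\<dots> \<le> \<Delta>\<^sup>2"
      using k\<delta> assms by (intro power_mono) auto
    finally show "real k * \<delta>\<^sup>2 \<le> \<Delta>\<^sup>2" .
    show "finite (grid k m \<delta> \<Delta>)"
      by (simp add: grid_clusters_def)
    show "partition_on (grid k m \<delta> \<Delta>) (grid_clusters k m \<delta> \<Delta>)"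
    proof (rule partition_onI)
      show "disjnt p q" if "p \<in> grid_clusters k m \<delta> \<Delta>" "q \<in> grid_clusters k m \<delta> \<Delta>" "p \<noteq> q" for p q
        using that disj unfolding grid_clusters_def disjnt_def by blast
      show "{} \<notin> grid_clusters k m \<delta> \<Delta>"
        using assms by (auto simp: grid_clusters_def lessThan_empty_iff)
    qed simp
    have "inj_on (\<lambda>i. ?x i ` {..<m}) {..<k}"
    proof (rule inj_onI, rule ccontr)
      fix i i' assume "i \<in> {..<k}" "i' \<in> {..<k}" "?x i ` {..<m} = ?x i' ` {..<m}" "i \<noteq> i'"
      with disj[of i i'] assms(2) show False by (auto simp: lessThan_empty_iff)
    qed
    thus "card (grid_clusters k m \<delta> \<Delta>) = k"
      by (simp add: grid_clusters_def card_image)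
    show "card A = m" if A: "A \<in> grid_clusters k m \<delta> \<Delta>" for A
    proof -
      obtain i where "i < k" "A = ?x i ` {..<m}" using A by (auto simp: grid_clusters_def)
      thus ?thesis by (simp add: card_image inj_on_def eq_iff)
    qed
    show "eucl_dist (k + k * m) x y = \<delta>"
      if "A \<in> grid_clusters k m \<delta> \<Delta>" "x \<in> A" "y \<in> A" "x \<noteq> y" for A x y
      using that by (auto simp: grid_clusters_def dist)
    show "eucl_dist (k + k * m) x y = \<Delta>"
      if AB: "A \<in> grid_clusters k m \<delta> \<Delta>" "B \<in> grid_clusters k m \<delta> \<Delta>" "A \<noteq> B" "x \<in> A" "y \<in> B" for A B x y
    proof -
      obtain i i' where "i < k" "i' < k" "A = ?x i ` {..<m}" "B = ?x i' ` {..<m}"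
        using AB(1,2) by (auto simp: grid_clusters_def)
      moreover from this AB(3) have "i \<noteq> i'" by auto
      ultimately show ?thesis
        using AB(4,5) by (auto simp: dist)
    qed
  qed (use assms in auto)
qed

lemma (in clustering) clustered_instance:
  assumes "X \<subseteq> topspace (Euclidean_space d)"
  shows "clustered_instance d k m \<delta> \<Delta> X"
  unfolding clustered_instance_def
  using assms finite part card_P card_cluster dist_same dist_diff by blast

section \<open>The joint limit and the cost ratio\<close>

lemma filterlim_ratio_at_top: "filterlim (\<lambda>(\<delta>, \<Delta>). \<Delta> / \<delta>) at_top ratio_at_top"
  unfolding ratio_at_top_def by (rule filterlim_mono[OF filterlim_filtercomap order.refl inf_le1])

lemma eventually_ratio_at_top:
  "eventually (\<lambda>(\<delta>, \<Delta>). 0 < \<delta> \<and> 0 < \<Delta> \<and> R \<le> \<Delta> / \<delta>) ratio_at_top"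
proof -
  have "eventually (\<lambda>(\<delta>, \<Delta>). 0 < \<delta> \<and> (0::real) < \<Delta>) ratio_at_top"
    unfolding ratio_at_top_def
    by (rule filter_leD[OF inf_le2]) (simp add: eventually_principal)
  moreover have "eventually (\<lambda>(\<delta>, \<Delta>). R \<le> \<Delta> / \<delta>) ratio_at_top"
    using filterlim_ratio_at_top by (auto simp: filterlim_at_top case_prod_unfold)
  ultimately show ?thesis
    by eventually_elim auto
qed

text \<open>The curve \<delta> = 1, \<Delta> = t with t tending to infinity follows this filter.
  Nontriviality allows a concrete pair to be extracted from properties that hold eventually.\<close>

lemma ratio_at_top_neq_bot: "ratio_at_top \<noteq> bot"
proof -
  have "filterlim (\<lambda>t. (1 :: real, t)) ratio_at_top (at_top :: real filter)"
    unfolding ratio_at_top_def filterlim_inf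
  proof
    show "filterlim (\<lambda>t. (1 :: real, t)) (filtercomap (\<lambda>(\<delta>, \<Delta>). \<Delta> / \<delta>) at_top) (at_top :: real filter)"
      by (simp add: filterlim_filtercomap_iff o_def filterlim_ident)
    show "filterlim (\<lambda>t. (1 :: real, t)) (principal {(\<delta>, \<Delta>). 0 < \<delta> \<and> (0::real) < \<Delta>}) (at_top :: real filter)"
      by (simp add: filterlim_principal eventually_gt_at_top)
  qed
  thus ?thesis
    by (auto simp: filterlim_def bot_unique filtermap_bot_iff)
qed

lemma expected_cost_grid_tendsto:
  assumes "2 \<le> k" "2 \<le> m" "0 \<le> \<epsilon>" "\<epsilon> < 1"
  shows "((\<lambda>(\<delta>, \<Delta>). expected_cost (k + k * m) k (grid k m \<delta> \<Delta>)
             (noisy_step (k + k * m) (grid k m \<delta> \<Delta>) (grid_clusters k m \<delta> \<Delta>) \<epsilon>) / \<delta>\<^sup>2) \<longlongrightarrow>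
           (real m - 1) * real k * (harm k + \<epsilon> * (harm k - 1))) ratio_at_top"
proof -
  have "filterlim (\<lambda>(\<delta>, \<Delta>). (\<Delta> / \<delta>)\<^sup>2) at_top ratio_at_top"
    using filterlim_pow_at_top[OF _ filterlim_ratio_at_top, of 2] by (simp add: case_prod_unfold)
  \<comment> \<open>The state 1 after the first round is written \<open>k - (k - 1)\<close> to match
    the miss-free states of \<open>cost_to_go_tendsto\<close>.\<close>
  hence "((\<lambda>(\<delta>, \<Delta>). cost_to_go k m \<epsilon> (k - 1) (k - (k - 1)) ((\<Delta> / \<delta>)\<^sup>2)) \<longlongrightarrow>
      (real m - 1) * (real k + (1 + \<epsilon>) * (real k * harm (k - 1) - real (k - 1)))) ratio_at_top"
    using filterlim_compose[OF cost_to_go_tendsto[of "k - 1" k m \<epsilon>]] assms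
    by (simp add: case_prod_unfold)
  also have "(real m - 1) * (real k + (1 + \<epsilon>) * (real k * harm (k - 1) - real (k - 1))) =
      (real m - 1) * real k * (harm k + \<epsilon> * (harm k - 1))"
  proof -
    have "real k * harm k = real k * harm (k - 1) + 1"
      using assms harm_Suc[of "k - 1", where 'a = real] by (simp add: field_simps)
    hence "real k * harm (k - 1) - real (k - 1) = real k * (harm k - 1)"
      using assms by (simp add: of_nat_diff algebra_simps)
    hence "(real m - 1) * (real k + (1 + \<epsilon>) * (real k * harm (k - 1) - real (k - 1))) =
        (real m - 1) * (real k + (1 + \<epsilon>) * (real k * (harm k - 1)))"
      by simp
    thus ?thesis by (simp add: algebra_simps)
  qed
  finally show ?thesis
  proof (rule Lim_transform_eventually)
    show "\<forall>\<^sub>F x in ratio_at_top.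
        (case x of (\<delta>, \<Delta>) \<Rightarrow> cost_to_go k m \<epsilon> (k - 1) (k - (k - 1)) ((\<Delta> / \<delta>)\<^sup>2)) =
        (case x of (\<delta>, \<Delta>) \<Rightarrow> expected_cost (k + k * m) k (grid k m \<delta> \<Delta>)
             (noisy_step (k + k * m) (grid k m \<delta> \<Delta>) (grid_clusters k m \<delta> \<Delta>) \<epsilon>) / \<delta>\<^sup>2)"
      using eventually_ratio_at_top[of "real k"]
    proof eventually_elim
      case (elim x)
      obtain \<delta> \<Delta> where x: "x = (\<delta>, \<Delta>)" by fastforce
      interpret clustering "k + k * m" k m \<delta> \<Delta> "grid k m \<delta> \<Delta>" "grid_clusters k m \<delta> \<Delta>"
        using elim assms by (intro clustering_grid) (auto simp: x)
      show ?case
        using elim assms by (simp add: x expected_cost_noisy_step)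
    qed
  qed
qed

lemma harm_ge_three_halves:
  assumes "2 \<le> k"
  shows "harm k \<ge> (3 / 2 :: real)"
proof -
  have "harm 2 \<le> (harm k :: real)" using assms by (rule harm_mono)
  thus ?thesis by (simp add: harm_expand)
qed

lemma expected_cost_ratio_tendsto:
  assumes "2 \<le> k" "2 \<le> m" "0 \<le> \<epsilon>" "\<epsilon> < 1"
  shows "((\<lambda>(\<delta>, \<Delta>). expected_cost (k + k * m) k (grid k m \<delta> \<Delta>)
             (noisy_step (k + k * m) (grid k m \<delta> \<Delta>) (grid_clusters k m \<delta> \<Delta>) \<epsilon>) /
           expected_cost (k + k * m) k (grid k m \<delta> \<Delta>) (exact_step (k + k * m) (grid k m \<delta> \<Delta>))) \<longlongrightarrow>
           1 + (harm k - 1) / harm k * \<epsilon>) ratio_at_top"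
proof -
  have H: "harm k \<noteq> (0::real)" using harm_ge_three_halves[OF assms(1)] by auto
  have c: "(real m - 1) * real k \<noteq> 0" using assms by auto
  \<comment> \<open>Both expected costs are scaled by \<delta>^2 to have finite limits; the scaling
    cancels where \<delta> > 0.\<close>
  have "((\<lambda>x. (case x of (\<delta>, \<Delta>) \<Rightarrow> expected_cost (k + k * m) k (grid k m \<delta> \<Delta>)
             (noisy_step (k + k * m) (grid k m \<delta> \<Delta>) (grid_clusters k m \<delta> \<Delta>) \<epsilon>) / \<delta>\<^sup>2) /
          (case x of (\<delta>, \<Delta>) \<Rightarrow> expected_cost (k + k * m) k (grid k m \<delta> \<Delta>)
             (noisy_step (k + k * m) (grid k m \<delta> \<Delta>) (grid_clusters k m \<delta> \<Delta>) 0) / \<delta>\<^sup>2)) \<longlongrightarrow>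
        ((real m - 1) * real k * (harm k + \<epsilon> * (harm k - 1))) /
        ((real m - 1) * real k * (harm k + 0 * (harm k - 1)))) ratio_at_top"
    using c H assms by (intro tendsto_divide expected_cost_grid_tendsto) auto
  also have "((real m - 1) * real k * (harm k + \<epsilon> * (harm k - 1))) /
        ((real m - 1) * real k * (harm k + 0 * (harm k - 1))) = 1 + (harm k - 1) / harm k * \<epsilon>"
    using c H by (simp add: add_divide_distrib)
  finally show ?thesis
  proof (rule Lim_transform_eventually)
  qed (use eventually_ratio_at_top[of 0] in eventually_elim, auto simp: noisy_step_0)
qed

text \<open>The quotient 1 - 1/H grows with H and equals 1/3 at H = 3/2, the harmonic number for k =
  2.\<close>

lemma harm_ratio_bound:
  assumes "2 \<le> k"
  shows "(harm k - 1) / harm k \<ge> (1 / 3 :: real)"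
proof -
  have "harm k \<ge> (3 / 2 :: real)" by (rule harm_ge_three_halves[OF assms])
  moreover from this have "harm k > (0 :: real)" by linarith
  ultimately show ?thesis by (simp add: pos_le_divide_eq)
qed

theorem theorem5p1:
  "(\<forall>k m :: nat. \<forall>\<epsilon> :: real. 2 \<le> k \<and> 2 \<le> m \<and> 0 \<le> \<epsilon> \<and> \<epsilon> < 1 \<longrightarrow>
      (\<exists>(d :: nat) (X :: real \<Rightarrow> real \<Rightarrow> point set) (q :: real \<Rightarrow> real \<Rightarrow> adversary) (R :: real).
         (\<forall>\<delta> \<Delta>. 0 < \<delta> \<and> 0 < \<Delta> \<and> R \<le> \<Delta> / \<delta> \<longrightarrow>
            clustered_instance d k m \<delta> \<Delta> (X \<delta> \<Delta>) \<and>
            valid_adversary d k \<epsilon> (X \<delta> \<Delta>) (q \<delta> \<Delta>)) \<and>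
         (\<exists>L :: real.
            ((\<lambda>(\<delta>, \<Delta>). expected_cost d k (X \<delta> \<Delta>) (q \<delta> \<Delta>) /
                       expected_cost d k (X \<delta> \<Delta>) (exact_step d (X \<delta> \<Delta>))) \<longlongrightarrow> L) ratio_at_top \<and>
            L \<ge> 1 + (harm k - 1) / harm k * \<epsilon> \<and>
            1 + (harm k - 1) / harm k * \<epsilon> \<ge> 1 + \<epsilon> / 3)))
   \<and>
   (\<exists>c > 0. \<forall>k :: nat. \<forall>\<epsilon> :: real. 2 \<le> k \<and> 0 \<le> \<epsilon> \<and> \<epsilon> < 1 \<longrightarrow>
      (\<exists>(d :: nat) (X :: point set) (q :: adversary).
         finite X \<and> X \<noteq> {} \<and> X \<subseteq> topspace (Euclidean_space d) \<and>
         valid_adversary d k \<epsilon> X q \<and>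
         0 < expected_cost d k X (exact_step d X) \<and>
         expected_cost d k X q \<ge> (1 + c * \<epsilon>) * expected_cost d k X (exact_step d X)))"
proof (intro conjI allI impI)
  fix k m :: nat and \<epsilon> :: real
  assume A: "2 \<le> k \<and> 2 \<le> m \<and> 0 \<le> \<epsilon> \<and> \<epsilon> < 1"
  let ?d = "k + k * m" and ?X = "grid k m"
  let ?q = "\<lambda>\<delta> \<Delta>. noisy_step ?d (?X \<delta> \<Delta>) (grid_clusters k m \<delta> \<Delta>) \<epsilon>"
  have inst: "clustered_instance ?d k m \<delta> \<Delta> (?X \<delta> \<Delta>) \<and> valid_adversary ?d k \<epsilon> (?X \<delta> \<Delta>) (?q \<delta> \<Delta>)"
    if "0 < \<delta> \<and> 0 < \<Delta> \<and> real k \<le> \<Delta> / \<delta>" for \<delta> \<Delta>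
  proof -
    interpret clustering ?d k m \<delta> \<Delta> "?X \<delta> \<Delta>" "grid_clusters k m \<delta> \<Delta>"
      using that A by (intro clustering_grid) auto
    show ?thesis
      using A clustered_instance[OF grid_subset_Euclidean_space] valid_adversary_noisy_step by auto
  qed
  have "1 / 3 * \<epsilon> \<le> (harm k - 1) / harm k * \<epsilon>"
    using A harm_ratio_bound by (intro mult_right_mono) auto
  thus "\<exists>d X q R.
         (\<forall>\<delta> \<Delta>. 0 < \<delta> \<and> 0 < \<Delta> \<and> R \<le> \<Delta> / \<delta> \<longrightarrow>
            clustered_instance d k m \<delta> \<Delta> (X \<delta> \<Delta>) \<and> valid_adversary d k \<epsilon> (X \<delta> \<Delta>) (q \<delta> \<Delta>)) \<and>
         (\<exists>L. ((\<lambda>(\<delta>, \<Delta>). expected_cost d k (X \<delta> \<Delta>) (q \<delta> \<Delta>) /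
                       expected_cost d k (X \<delta> \<Delta>) (exact_step d (X \<delta> \<Delta>))) \<longlongrightarrow> L) ratio_at_top \<and>
            L \<ge> 1 + (harm k - 1) / harm k * \<epsilon> \<and>
            1 + (harm k - 1) / harm k * \<epsilon> \<ge> 1 + \<epsilon> / 3)"
    \<comment> \<open>The threshold k of \<open>clustering_grid\<close> serves as \<open>R\<close>,
      and the limit \<open>L\<close> equals the claimed lower bound.\<close>
    using inst A
    by (intro exI[of _ ?d] exI[of _ ?X] exI[of _ ?q] exI[of _ "real k"] conjI
          exI[of _ "1 + (harm k - 1) / harm k * \<epsilon>"] expected_cost_ratio_tendsto) auto
next
  show "\<exists>c>0. \<forall>k \<epsilon>. 2 \<le> k \<and> 0 \<le> \<epsilon> \<and> \<epsilon> < 1 \<longrightarrow>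
      (\<exists>d X q. finite X \<and> X \<noteq> {} \<and> X \<subseteq> topspace (Euclidean_space d) \<and>
         valid_adversary d k \<epsilon> X q \<and>
         0 < expected_cost d k X (exact_step d X) \<and>
         expected_cost d k X q \<ge> (1 + c * \<epsilon>) * expected_cost d k X (exact_step d X))"
  \<comment> \<open>Any positive constant below 1/3 would do: for \<epsilon> > 0 the limit then
    exceeds 1 + c \<epsilon> strictly, so the ratio does so at some concrete instance. Clusters of
    size 2 suffice.\<close>
  proof (rule exI[of _ "1 / 6"], intro conjI allI impI)
    fix k :: nat and \<epsilon> :: real
    assume A: "2 \<le> k \<and> 0 \<le> \<epsilon> \<and> \<epsilon> < 1"
    let ?d = "k + k * 2" and ?X = "grid k 2" and ?P = "grid_clusters k 2"
    let ?E = "\<lambda>\<epsilon> \<delta> \<Delta>. expected_cost ?d k (?X \<delta> \<Delta>) (noisy_step ?d (?X \<delta> \<Delta>) (?P \<delta> \<Delta>) \<epsilon>)"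
    have bound: "1 / 3 * \<epsilon> \<le> (harm k - 1) / harm k * \<epsilon>"
      using A harm_ratio_bound by (intro mult_right_mono) auto
    have lim: "((\<lambda>(\<delta>, \<Delta>). ?E \<epsilon> \<delta> \<Delta> / ?E 0 \<delta> \<Delta>) \<longlongrightarrow> 1 + (harm k - 1) / harm k * \<epsilon>) ratio_at_top"
      using expected_cost_ratio_tendsto[of k 2 \<epsilon>] A by (simp add: noisy_step_0)
    \<comment> \<open>For \<epsilon> = 0 the strict gap is lost, but the final inequality is then
      trivial.\<close>
    have "\<forall>\<^sub>F (\<delta>, \<Delta>) in ratio_at_top. \<epsilon> = 0 \<or> 1 + 1 / 6 * \<epsilon> \<le> ?E \<epsilon> \<delta> \<Delta> / ?E 0 \<delta> \<Delta>"
    proof (cases "\<epsilon> = 0")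
      case False
      hence "1 + 1 / 6 * \<epsilon> < 1 + (harm k - 1) / harm k * \<epsilon>"
        using A bound by linarith
      from order_tendstoD(1)[OF lim this] show ?thesis
        by eventually_elim auto
    qed (simp add: case_prod_unfold)
    \<comment> \<open>Division by 0 yields 0, so a positive ratio rules out a vanishing exact cost;
      with nonnegativity this makes the exact cost positive.\<close>
    moreover have "\<forall>\<^sub>F (\<delta>, \<Delta>) in ratio_at_top. 0 < ?E \<epsilon> \<delta> \<Delta> / ?E 0 \<delta> \<Delta>"
    proof -
      have "0 < 1 + (harm k - 1) / harm k * \<epsilon>"
        using A bound by linarith
      from order_tendstoD(1)[OF lim this] show ?thesis
        by (simp add: case_prod_unfold)
    qed
    ultimately have "\<forall>\<^sub>F (\<delta>, \<Delta>) in ratio_at_top.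
        (\<epsilon> = 0 \<or> 1 + 1 / 6 * \<epsilon> \<le> ?E \<epsilon> \<delta> \<Delta> / ?E 0 \<delta> \<Delta>) \<and> 0 < ?E \<epsilon> \<delta> \<Delta> / ?E 0 \<delta> \<Delta> \<and>
        0 < \<delta> \<and> 0 < \<Delta> \<and> real k \<le> \<Delta> / \<delta>"
      using eventually_ratio_at_top[of "real k"] by eventually_elim auto
    then obtain \<delta> \<Delta> where
        *: "\<epsilon> = 0 \<or> 1 + 1 / 6 * \<epsilon> \<le> ?E \<epsilon> \<delta> \<Delta> / ?E 0 \<delta> \<Delta>" "0 < ?E \<epsilon> \<delta> \<Delta> / ?E 0 \<delta> \<Delta>"
      and \<delta>\<Delta>: "0 < \<delta>" "0 < \<Delta>" "real k \<le> \<Delta> / \<delta>"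
      using eventually_happens'[OF ratio_at_top_neq_bot] by fastforce
    interpret clustering ?d k 2 \<delta> \<Delta> "?X \<delta> \<Delta>" "?P \<delta> \<Delta>"
      using \<delta>\<Delta> A by (intro clustering_grid) auto
    have "0 \<le> ?E 0 \<delta> \<Delta>"
      unfolding expected_cost_def
    proof (intro integral_nonneg_AE AE_pmfI)
      fix h assume "h \<in> set_pmf (sample_centers (noisy_step ?d (?X \<delta> \<Delta>) (?P \<delta> \<Delta>) 0) k)"
      hence "length h = k" using set_sample_centers[of 0 k h] by auto
      thus "0 \<le> kmeans_cost ?d (?X \<delta> \<Delta>) (set h)"
        using A by (intro kmeans_cost_nonneg) auto
    qed
    with * have pos: "0 < ?E 0 \<delta> \<Delta>"
      by (simp add: zero_less_divide_iff)
    have "(1 + 1 / 6 * \<epsilon>) * ?E 0 \<delta> \<Delta> \<le> ?E \<epsilon> \<delta> \<Delta>"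
      using *(1) pos by (auto simp: pos_le_divide_eq)
    moreover have "?X \<delta> \<Delta> \<noteq> {}"
      using card_X A card.empty by fastforce
    ultimately show "\<exists>d X q. finite X \<and> X \<noteq> {} \<and> X \<subseteq> topspace (Euclidean_space d) \<and>
         valid_adversary d k \<epsilon> X q \<and>
         0 < expected_cost d k X (exact_step d X) \<and>
         expected_cost d k X q \<ge> (1 + 1 / 6 * \<epsilon>) * expected_cost d k X (exact_step d X)"
      using A pos finite grid_subset_Euclidean_space[of k 2 \<delta> \<Delta>] valid_adversary_noisy_step[of \<epsilon>]
      unfolding noisy_step_0 by blast
  qed simp
qed

end
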